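(* Let $G$ be a directed po-group, $I$ a set and $\phi:I\to I$ a bijection. Let $u=(1,e^I)$. Then the unital po-group $(\mathbb Z\ltimes_\phi G,u)$ satisfies RDP (RDP$_1$, RDP$_2$, respectively) if and only if $G$ satisfies RDP (RDP$_1$, RDP$_2$, respectively).
   Context: Po-groups (partially ordered groups, not necessarily Abelian) are written multiplicatively with identity $e$; $G^+=\{g\in G: g\ge e\}$. $G$ is directed if any two elements have a common upper bound. A strong unit of a po-group $H$ is $u\in H^+$ such that every $h\in H$ satisfies $h\le u^k$ for some integer $k\ge1$; a unital po-group is a pair $(H,u)$ with $u$ a strong unit. A po-group $G$ satisfies RDP if for all $a_1,a_2,b_1,b_2\in G^+$ with $a_1a_2=b_1b_2$ there are $c_{11},c_{12},c_{21},c_{22}\in G^+$ with $a_1=c_{11}c_{12}$, $a_2=c_{21}c_{22}$, $b_1=c_{11}c_{21}$, $b_2=c_{12}c_{22}$. It satisfies RDP$_1$ if the $c_{ij}$ can always be chosen so that in addition $e\le x\le c_{12}$ and $e\le y\le c_{21}$ imply $xy=yx$. It satisfies RDP$_2$ if the $c_{ij}$ can always be chosen so that in addition $c_{12}\wedge c_{21}=e$. A unital po-group satisfies one of these properties if the underlying po-group does. For a bijection $\phi:I\to I$, $\mathbb Z\ltimes_\phi G$ is the po-group with underlying set $\mathbb Z\times G^I$, multiplication $(n,\langle x_i\rangle)*_\phi(m,\langle y_i\rangle)=(n+m,\langle x_iy_{\phi^n(i)}\rangle)$, identity $(0,e^I)$ ($e^I$ the constant sequence $e$), and order $(n,\langle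 x_i\rangle)\le(m,\langle y_i\rangle)$ iff $n<m$, or $n=m$ and $x_i\le y_i$ for all $i\in I$; $u=(1,e^I)$ is a strong unit.
   Formalization: The set I is assumed nonempty: for empty I the po-group is isomorphic to the integers and satisfies RDP, RDP1 and RDP2 even if G does not (e.g. G the integers with positive cone {0,2,3,...}). *)

theory Defs
  imports "HOL-Algebra.Algebra"
begin

record 'a po_group = "'a monoid" +
  po_le :: "['a, 'a] \<Rightarrow> bool"  (infixl "\<preceq>\<index>" 50)

text \<open>The order reduct, so that HOL-Algebra's \<^locale>\<open>partial_order\<close>, \<^const>\<open>greatest\<close>
  and \<^const>\<open>Lower\<close> apply.\<close>

definition order_of :: "('a, 'b) po_group_scheme \<Rightarrow> 'a gorder" where
  "order_of G = \<lparr>carrier = carrier G, eq = (=), le = po_le G\<rparr>"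

locale po_group = group G + order: partial_order "order_of G"
  for G :: "('a, 'b) po_group_scheme" (structure) +
  assumes translate:
    "\<lbrakk>a \<in> carrier G; b \<in> carrier G; c \<in> carrier G; d \<in> carrier G; a \<preceq> b\<rbrakk>
      \<Longrightarrow> c \<otimes> a \<otimes> d \<preceq> c \<otimes> b \<otimes> d"

definition pos_cone :: "('a, 'b) po_group_scheme \<Rightarrow> 'a set" where
  "pos_cone G = {g \<in> carrier G. \<one>\<^bsub>G\<^esub> \<preceq>\<^bsub>G\<^esub> g}"

definition directed :: "('a, 'b) po_group_scheme \<Rightarrow> bool" where
  "directed G \<longleftrightarrow>
    (\<forall>x \<in> carrier G. \<forall>y \<in> carrier G. \<exists>z \<in> carrier G. x \<preceq>\<^bsub>G\<^esub> z \<and> y \<preceq>\<^bsub>G\<^esub> z)"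

definition strong_unit :: "('a, 'b) po_group_scheme \<Rightarrow> 'a \<Rightarrow> bool" where
  "strong_unit H u \<longleftrightarrow>
    u \<in> pos_cone H \<and> (\<forall>h \<in> carrier H. \<exists>k::nat. k \<ge> 1 \<and> h \<preceq>\<^bsub>H\<^esub> u [^]\<^bsub>H\<^esub> k)"

definition unital_po_group :: "('a, 'b) po_group_scheme \<Rightarrow> 'a \<Rightarrow> bool" where
  "unital_po_group H u \<longleftrightarrow> po_group H \<and> strong_unit H u"

text \<open>The value \<open>g\<close> is the infimum of \<open>a\<close> and \<open>b\<close> in the whole po-group, not merely in its
  positive cone; in particular the predicate asserts that the infimum exists.\<close>

definition is_meet :: "('a, 'b) po_group_scheme \<Rightarrow> 'a \<Rightarrow> 'a \<Rightarrow> 'a \<Rightarrow> bool" where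
  "is_meet G g a b \<longleftrightarrow> greatest (order_of G) g (Lower (order_of G) {a, b})"

definition decomposition ::
  "('a, 'b) po_group_scheme \<Rightarrow> 'a \<Rightarrow> 'a \<Rightarrow> 'a \<Rightarrow> 'a \<Rightarrow> 'a \<Rightarrow> 'a \<Rightarrow> 'a \<Rightarrow> 'a \<Rightarrow> bool" where
  "decomposition G a1 a2 b1 b2 c11 c12 c21 c22 \<longleftrightarrow>
    c11 \<in> pos_cone G \<and> c12 \<in> pos_cone G \<and> c21 \<in> pos_cone G \<and> c22 \<in> pos_cone G \<and>
    a1 = c11 \<otimes>\<^bsub>G\<^esub> c12 \<and> a2 = c21 \<otimes>\<^bsub>G\<^esub> c22 \<and>
    b1 = c11 \<otimes>\<^bsub>G\<^esub> c21 \<and> b2 = c12 \<otimes>\<^bsub>G\<^esub> c22"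

definition RDP :: "('a, 'b) po_group_scheme \<Rightarrow> bool" where
  "RDP G \<longleftrightarrow>
    (\<forall>a1 \<in> pos_cone G. \<forall>a2 \<in> pos_cone G. \<forall>b1 \<in> pos_cone G. \<forall>b2 \<in> pos_cone G.
      a1 \<otimes>\<^bsub>G\<^esub> a2 = b1 \<otimes>\<^bsub>G\<^esub> b2 \<longrightarrow>
      (\<exists>c11 c12 c21 c22. decomposition G a1 a2 b1 b2 c11 c12 c21 c22))"

definition RDP1 :: "('a, 'b) po_group_scheme \<Rightarrow> bool" where
  "RDP1 G \<longleftrightarrow>
    (\<forall>a1 \<in> pos_cone G. \<forall>a2 \<in> pos_cone G. \<forall>b1 \<in> pos_cone G. \<forall>b2 \<in> pos_cone G.
      a1 \<otimes>\<^bsub>G\<^esub> a2 = b1 \<otimes>\<^bsub>G\<^esub> b2 \<longrightarrow>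
      (\<exists>c11 c12 c21 c22. decomposition G a1 a2 b1 b2 c11 c12 c21 c22 \<and>
        (\<forall>x \<in> pos_cone G. \<forall>y \<in> pos_cone G. x \<preceq>\<^bsub>G\<^esub> c12 \<and> y \<preceq>\<^bsub>G\<^esub> c21 \<longrightarrow>
          x \<otimes>\<^bsub>G\<^esub> y = y \<otimes>\<^bsub>G\<^esub> x)))"

definition RDP2 :: "('a, 'b) po_group_scheme \<Rightarrow> bool" where
  "RDP2 G \<longleftrightarrow>
    (\<forall>a1 \<in> pos_cone G. \<forall>a2 \<in> pos_cone G. \<forall>b1 \<in> pos_cone G. \<forall>b2 \<in> pos_cone G.
      a1 \<otimes>\<^bsub>G\<^esub> a2 = b1 \<otimes>\<^bsub>G\<^esub> b2 \<longrightarrow>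
      (\<exists>c11 c12 c21 c22. decomposition G a1 a2 b1 b2 c11 c12 c21 c22 \<and>
        is_meet G \<one>\<^bsub>G\<^esub> c12 c21))"

text \<open>The integer iterate \<open>\<phi>\<^sup>n\<close> of a bijection of \<open>I\<close>, as a power in the group of bijections of
  \<open>I\<close>; elements of that group are extensional functions, hence the restriction.\<close>

definition iter :: "'i set \<Rightarrow> ('i \<Rightarrow> 'i) \<Rightarrow> int \<Rightarrow> 'i \<Rightarrow> 'i" where
  "iter I \<phi> n = restrict \<phi> I [^]\<^bsub>BijGroup I\<^esub> n"

text \<open>Elements of the power \<open>G\<^sup>I\<close> are extensional functions from \<open>I\<close> to the carrier of \<open>G\<close>.\<close>

definition semidirect ::
  "'i set \<Rightarrow> ('i \<Rightarrow> 'i) \<Rightarrow> ('a, 'b) po_group_scheme \<Rightarrow> (int \<times> ('i \<Rightarrow> 'a)) po_group" where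
  "semidirect I \<phi> G =
    \<lparr>carrier = UNIV \<times> (I \<rightarrow>\<^sub>E carrier G),
     monoid.mult = (\<lambda>(n, x) (m, y). (n + m, \<lambda>i\<in>I. x i \<otimes>\<^bsub>G\<^esub> y (iter I \<phi> n i))),
     one = (0, \<lambda>i\<in>I. \<one>\<^bsub>G\<^esub>),
     po_le = (\<lambda>(n, x) (m, y). n < m \<or> (n = m \<and> (\<forall>i\<in>I. x i \<preceq>\<^bsub>G\<^esub> y i)))\<rparr>"

end

theory Submission
  imports Defs
begin

text \<open>Call \<open>n\<close> the degree of \<open>(n, x)\<close>. The elements of degree \<open>0\<close> form a copy of the power
  \<open>G\<^sup>I\<close>, which inherits and reflects each of the three properties coordinatewise.
  Let \<open>a\<^sub>1 a\<^sub>2 = b\<^sub>1 b\<^sub>2\<close> in the positive cone. If the degree of \<open>b\<^sub>1\<close> is smaller than that of \<open>a\<^sub>1\<close>,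
  then \<open>b\<^sub>1\<inverse> a\<^sub>1\<close> is positive and the table with rows \<open>b\<^sub>1, b\<^sub>1\<inverse> a\<^sub>1\<close> and \<open>e, a\<^sub>2\<close> does it; the
  opposite case is symmetric. If the degrees agree, directedness yields positive common lower
  bounds \<open>d\<close> of \<open>a\<^sub>1, b\<^sub>1\<close> and \<open>d'\<close> of \<open>a\<^sub>2, b\<^sub>2\<close> having the same degrees. Then
  \<open>(d\<inverse> a\<^sub>1) (a\<^sub>2 d'\<inverse>) = (d\<inverse> b\<^sub>1) (b\<^sub>2 d'\<inverse>)\<close> holds in degree \<open>0\<close>, and multiplying \<open>c\<^sub>1\<^sub>1\<close> by \<open>d\<close>
  on the left and \<open>c\<^sub>2\<^sub>2\<close> by \<open>d'\<close> on the right leaves \<open>c\<^sub>1\<^sub>2\<close> and \<open>c\<^sub>2\<^sub>1\<close> untouched.\<close>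

section \<open>One schema for the three decomposition properties\<close>

text \<open>RDP, RDP1 and RDP2 differ only in what they ask of the two off-diagonal entries
  \<open>c12\<close>, \<open>c21\<close>. With that side condition as a parameter \<open>P\<close>,
  the transfer is proved once for all three.\<close>

definition RDP_with :: "('a \<Rightarrow> 'a \<Rightarrow> bool) \<Rightarrow> ('a, 'b) po_group_scheme \<Rightarrow> bool" where
  "RDP_with P G \<longleftrightarrow>
    (\<forall>a1 \<in> pos_cone G. \<forall>a2 \<in> pos_cone G. \<forall>b1 \<in> pos_cone G. \<forall>b2 \<in> pos_cone G.
      a1 \<otimes>\<^bsub>G\<^esub> a2 = b1 \<otimes>\<^bsub>G\<^esub> b2 \<longrightarrow>
      (\<exists>c11 c12 c21 c22. decomposition G a1 a2 b1 b2 c11 c12 c21 c22 \<and> P c12 c21))"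

definition commuting_below :: "('a, 'b) po_group_scheme \<Rightarrow> 'a \<Rightarrow> 'a \<Rightarrow> bool" where
  "commuting_below G c d \<longleftrightarrow>
    (\<forall>x \<in> pos_cone G. \<forall>y \<in> pos_cone G. x \<preceq>\<^bsub>G\<^esub> c \<and> y \<preceq>\<^bsub>G\<^esub> d \<longrightarrow>
      x \<otimes>\<^bsub>G\<^esub> y = y \<otimes>\<^bsub>G\<^esub> x)"

lemma RDP_eq_RDP_with: "RDP G \<longleftrightarrow> RDP_with (\<lambda>_ _. True) G"
  unfolding RDP_def RDP_with_def by simp

lemma RDP1_eq_RDP_with: "RDP1 G \<longleftrightarrow> RDP_with (commuting_below G) G"
  unfolding RDP1_def RDP_with_def commuting_below_def by simp

lemma RDP2_eq_RDP_with: "RDP2 G \<longleftrightarrow> RDP_with (is_meet G \<one>\<^bsub>G\<^esub>) G"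
  unfolding RDP2_def RDP_with_def by simp

lemma RDP_withD:
  assumes "RDP_with P G" "a1 \<in> pos_cone G" "a2 \<in> pos_cone G" "b1 \<in> pos_cone G" "b2 \<in> pos_cone G"
    and "a1 \<otimes>\<^bsub>G\<^esub> a2 = b1 \<otimes>\<^bsub>G\<^esub> b2"
  shows "\<exists>c11 c12 c21 c22. decomposition G a1 a2 b1 b2 c11 c12 c21 c22 \<and> P c12 c21"
  using assms unfolding RDP_with_def by blast

text \<open>The guards \<open>a \<in> carrier G\<close> and \<open>b \<in> carrier G\<close> come
  from \<open>Lower\<close>, which intersects the given set with the carrier.\<close>

lemma is_meet_iff:
  "is_meet G g a b \<longleftrightarrow> g \<in> carrier G \<and> (a \<in> carrier G \<longrightarrow> g \<preceq>\<^bsub>G\<^esub> a) \<and> (b \<in> carrier G \<longrightarrow> g \<preceq>\<^bsub>G\<^esub> b) \<and>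
    (\<forall>h \<in> carrier G. (a \<in> carrier G \<longrightarrow> h \<preceq>\<^bsub>G\<^esub> a) \<and> (b \<in> carrier G \<longrightarrow> h \<preceq>\<^bsub>G\<^esub> b) \<longrightarrow> h \<preceq>\<^bsub>G\<^esub> g)"
  unfolding is_meet_def greatest_def Lower_def order_of_def by auto

lemma pos_coneD: "x \<in> pos_cone G \<Longrightarrow> x \<in> carrier G \<and> \<one>\<^bsub>G\<^esub> \<preceq>\<^bsub>G\<^esub> x"
  by (simp add: pos_cone_def)

lemma pos_cone_carrier: "x \<in> pos_cone G \<Longrightarrow> x \<in> carrier G"
  by (simp add: pos_cone_def)

lemma po_groupI:
  fixes G (structure)
  assumes "group G"
    and "\<And>x. x \<in> carrier G \<Longrightarrow> x \<preceq> x"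
    and "\<And>x y. \<lbrakk>x \<in> carrier G; y \<in> carrier G; x \<preceq> y; y \<preceq> x\<rbrakk> \<Longrightarrow> x = y"
    and "\<And>x y z. \<lbrakk>x \<in> carrier G; y \<in> carrier G; z \<in> carrier G; x \<preceq> y; y \<preceq> z\<rbrakk> \<Longrightarrow> x \<preceq> z"
    and "\<And>a b c d. \<lbrakk>a \<in> carrier G; b \<in> carrier G; c \<in> carrier G; d \<in> carrier G; a \<preceq> b\<rbrakk>
      \<Longrightarrow> c \<otimes> a \<otimes> d \<preceq> c \<otimes> b \<otimes> d"
  shows "po_group G"
proof -
  have "partial_order (order_of G)"
    by unfold_locales (simp_all add: order_of_def, meson assms(2), meson assms(3), meson assms(4))
  then show ?thesis
    using assms(1,5) by (simp add: po_group_def po_group_axioms_def)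
qed

section \<open>Order arithmetic and decomposition tables in a po-group\<close>

context po_group
begin

lemma po_refl: "x \<in> carrier G \<Longrightarrow> x \<preceq> x"
  using order.le_refl[of x] by (simp add: order_of_def)

lemma po_antisym: "\<lbrakk>x \<preceq> y; y \<preceq> x; x \<in> carrier G; y \<in> carrier G\<rbrakk> \<Longrightarrow> x = y"
  using order.le_antisym[of x y] by (simp add: order_of_def)

lemma po_trans: "\<lbrakk>x \<preceq> y; y \<preceq> z; x \<in> carrier G; y \<in> carrier G; z \<in> carrier G\<rbrakk> \<Longrightarrow> x \<preceq> z"
  using order.le_trans[of x y z] by (simp add: order_of_def)

lemma translate_left:
  "\<lbrakk>a \<in> carrier G; b \<in> carrier G; c \<in> carrier G; a \<preceq> b\<rbrakk> \<Longrightarrow> c \<otimes> a \<preceq> c \<otimes> b"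
  using translate[of a b c \<one>] by simp

lemma translate_right:
  "\<lbrakk>a \<in> carrier G; b \<in> carrier G; c \<in> carrier G; a \<preceq> b\<rbrakk> \<Longrightarrow> a \<otimes> c \<preceq> b \<otimes> c"
  using translate[of a b \<one> c] by simp

lemma one_in_pos_cone: "\<one> \<in> pos_cone G"
  by (simp add: pos_cone_def po_refl)

lemma pos_cone_mult: "\<lbrakk>x \<in> pos_cone G; y \<in> pos_cone G\<rbrakk> \<Longrightarrow> x \<otimes> y \<in> pos_cone G"
  using translate_left[of \<one> y x] po_trans[of \<one> x "x \<otimes> y"] by (auto simp: pos_cone_def)

lemma inv_mult_in_pos_cone:
  "\<lbrakk>x \<in> carrier G; y \<in> carrier G; x \<preceq> y\<rbrakk> \<Longrightarrow> inv x \<otimes> y \<in> pos_cone G"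
  using translate_left[of x y "inv x"] by (simp add: pos_cone_def)

lemma mult_inv_in_pos_cone:
  "\<lbrakk>x \<in> carrier G; y \<in> carrier G; x \<preceq> y\<rbrakk> \<Longrightarrow> y \<otimes> inv x \<in> pos_cone G"
  using translate_right[of x y "inv x"] by (simp add: pos_cone_def)

lemma inv_le_flip:
  assumes "x \<in> carrier G" "y \<in> carrier G" "inv x \<preceq> y"
  shows "inv y \<preceq> x"
  using translate[of "inv x" y x "inv y"] assms by (simp add: m_assoc)

text \<open>Inversion reverses the order, so the inverse of an upper bound of \<open>inv x\<close>
  and \<open>inv y\<close> is a lower bound of \<open>x\<close> and \<open>y\<close>.\<close>

lemma directed_lower_bound:
  assumes "directed G" "x \<in> carrier G" "y \<in> carrier G"
  shows "\<exists>z \<in> carrier G. z \<preceq> x \<and> z \<preceq> y"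
proof -
  obtain w where "w \<in> carrier G" "inv x \<preceq> w" "inv y \<preceq> w"
    using assms unfolding directed_def by (meson inv_closed)
  then show ?thesis
    using assms(2,3) inv_le_flip[of x w] inv_le_flip[of y w] inv_closed[of w] by blast
qed

text \<open>\<open>c11\<close> is the leading factor of the first row and of the first column,
  \<open>c22\<close> the trailing factor of the second ones. Extending them outwards keeps the
  off-diagonal entries, hence any side condition on these.\<close>

lemma decomposition_mult_outer:
  assumes c: "decomposition G p p' q q' c11 c12 c21 c22"
    and d: "d \<in> pos_cone G" "d' \<in> pos_cone G"
  shows "decomposition G (d \<otimes> p) (p' \<otimes> d') (d \<otimes> q) (q' \<otimes> d') (d \<otimes> c11) c12 c21 (c22 \<otimes> d')"
proof -
  have "c11 \<in> carrier G" "c12 \<in> carrier G" "c21 \<in> carrier G" "c22 \<in> carrier G"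
    "d \<in> carrier G" "d' \<in> carrier G"
    using c d by (auto simp: decomposition_def pos_cone_def)
  then show ?thesis
    using c d pos_cone_mult by (auto simp: decomposition_def m_assoc)
qed

lemma decomposition_of_le_left:
  assumes pos: "a1 \<in> pos_cone G" "a2 \<in> pos_cone G" "b1 \<in> pos_cone G" "b2 \<in> pos_cone G"
    and eq: "a1 \<otimes> a2 = b1 \<otimes> b2" and le: "b1 \<preceq> a1"
  shows "decomposition G a1 a2 b1 b2 b1 (inv b1 \<otimes> a1) \<one> a2"
proof -
  note carr = pos[THEN pos_cone_carrier]
  have "inv b1 \<otimes> a1 \<otimes> a2 = b2"
    using carr eq by (simp add: m_assoc inv_solve_left')
  then show ?thesis
    using carr pos le inv_mult_in_pos_cone[of b1 a1] one_in_pos_cone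
    by (auto simp: decomposition_def m_assoc[symmetric])
qed

lemma decomposition_swap:
  "decomposition G a1 a2 b1 b2 c11 c12 c21 c22 \<Longrightarrow> decomposition G b1 b2 a1 a2 c11 c21 c12 c22"
  by (auto simp: decomposition_def)

lemma pos_below_one: "\<lbrakk>x \<in> pos_cone G; x \<preceq> \<one>\<rbrakk> \<Longrightarrow> x = \<one>"
  by (simp add: pos_cone_def po_antisym)

text \<open>The only positive element below \<open>\<one>\<close> is \<open>\<one>\<close> itself,
  and it is central. This and the next three lemmas supply the side conditions for tables with a
  trivial off-diagonal entry.\<close>

lemma commuting_below_one_left: "c \<in> pos_cone G \<Longrightarrow> commuting_below G \<one> c"
  unfolding commuting_below_def by (metis pos_below_one pos_cone_carrier l_one r_one)

lemma commuting_below_one_right: "c \<in> pos_cone G \<Longrightarrow> commuting_below G c \<one>"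
  unfolding commuting_below_def by (metis pos_below_one pos_cone_carrier l_one r_one)

lemma is_meet_one_left: "c \<in> pos_cone G \<Longrightarrow> is_meet G \<one> \<one> c"
  by (auto simp: is_meet_iff pos_cone_def po_refl)

lemma is_meet_one_right: "c \<in> pos_cone G \<Longrightarrow> is_meet G \<one> c \<one>"
  by (auto simp: is_meet_iff pos_cone_def po_refl)

end

section \<open>The semidirect product as a unital po-group\<close>

locale semidirect_power = po_group G for G :: "('a, 'b) po_group_scheme" (structure) +
  fixes I :: "'i set" and \<phi> :: "'i \<Rightarrow> 'i"
  assumes bij: "bij_betw \<phi> I I"
begin

abbreviation H :: "(int \<times> ('i \<Rightarrow> 'a)) po_group" where
  "H \<equiv> semidirect I \<phi> G"

lemma H_carrier: "(n, x) \<in> carrier H \<longleftrightarrow> x \<in> I \<rightarrow>\<^sub>E carrier G"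
  by (simp add: semidirect_def)

lemma H_mult: "(n, x) \<otimes>\<^bsub>H\<^esub> (m, y) = (n + m, \<lambda>i\<in>I. x i \<otimes> y (iter I \<phi> n i))"
  by (simp add: semidirect_def)

lemma H_one: "\<one>\<^bsub>H\<^esub> = (0, \<lambda>i\<in>I. \<one>)"
  by (simp add: semidirect_def)

lemma H_le: "(n, x) \<preceq>\<^bsub>H\<^esub> (m, y) \<longleftrightarrow> n < m \<or> n = m \<and> (\<forall>i\<in>I. x i \<preceq> y i)"
  by (simp add: semidirect_def)

lemma fst_H_mult: "fst (a \<otimes>\<^bsub>H\<^esub> b) = fst a + fst b"
  by (cases a; cases b) (simp add: H_mult)

lemma H_le_if_fst_less: "fst a < fst b \<Longrightarrow> a \<preceq>\<^bsub>H\<^esub> b"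
  by (cases a; cases b) (simp add: H_le)

lemma restrict_in_BijGroup: "restrict \<phi> I \<in> carrier (BijGroup I)"
  using bij by (simp add: BijGroup_def Bij_def bij_betw_restrict_eq)

lemma iter_in_Bij: "iter I \<phi> n \<in> Bij I"
proof -
  have "iter I \<phi> n \<in> carrier (BijGroup I)"
    unfolding iter_def by (rule group.int_pow_closed[OF group_BijGroup restrict_in_BijGroup])
  then show ?thesis
    unfolding BijGroup_def by simp
qed

lemma iter_closed: "i \<in> I \<Longrightarrow> iter I \<phi> n i \<in> I"
  using iter_in_Bij[of n] bij_betw_apply[of "iter I \<phi> n" I I i] by (simp add: Bij_def)

lemma iter_zero: "i \<in> I \<Longrightarrow> iter I \<phi> 0 i = i"
  by (simp add: iter_def BijGroup_def int_pow_def)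

text \<open>The product of \<open>BijGroup I\<close> is composition, so this is the power law read
  after exchanging the commuting exponents. The order of application is the one that associativity
  of the twisted product produces.\<close>

lemma iter_add: "i \<in> I \<Longrightarrow> iter I \<phi> (n + m) i = iter I \<phi> m (iter I \<phi> n i)"
proof -
  assume i: "i \<in> I"
  have "iter I \<phi> (m + n) = compose I (iter I \<phi> m) (iter I \<phi> n)"
    using group.int_pow_mult[OF group_BijGroup restrict_in_BijGroup, of m n] iter_in_Bij
    unfolding iter_def by (simp add: BijGroup_def)
  then show ?thesis
    using i by (simp add: compose_def add.commute)
qed

lemma H_group: "group H"
proof (rule groupI)
  fix a b assume "a \<in> carrier H" "b \<in> carrier H"
  then show "a \<otimes>\<^bsub>H\<^esub> b \<in> carrier H"
    by (cases a; cases b) (auto simp: H_carrier H_mult iter_closed PiE_iff)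
next
  show "\<one>\<^bsub>H\<^esub> \<in> carrier H"
    by (simp add: H_one H_carrier)
next
  fix a b c assume "a \<in> carrier H" "b \<in> carrier H" "c \<in> carrier H"
  then show "a \<otimes>\<^bsub>H\<^esub> b \<otimes>\<^bsub>H\<^esub> c = a \<otimes>\<^bsub>H\<^esub> (b \<otimes>\<^bsub>H\<^esub> c)"
    by (cases a; cases b; cases c)
      (auto simp: H_carrier H_mult iter_closed iter_add PiE_iff m_assoc intro!: restrict_ext)
next
  fix a assume "a \<in> carrier H"
  then show "\<one>\<^bsub>H\<^esub> \<otimes>\<^bsub>H\<^esub> a = a"
    by (cases a) (auto simp: H_carrier H_mult H_one iter_zero PiE_iff fun_eq_iff extensional_def)
next
  fix a assume a: "a \<in> carrier H"
  obtain n x where nx: "a = (n, x)" by (cases a)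
  show "\<exists>b \<in> carrier H. b \<otimes>\<^bsub>H\<^esub> a = \<one>\<^bsub>H\<^esub>"
    \<comment> \<open>Multiplying from the left by an element of degree \<open>- n\<close> reads
      \<open>x\<close> at the index \<open>iter I \<phi> (- n) i\<close>, so the inverse must be
      taken at that index.\<close>
    by (rule bexI[of _ "(- n, \<lambda>i\<in>I. inv (x (iter I \<phi> (- n) i)))"])
      (use a nx in \<open>auto simp: H_carrier H_mult H_one iter_closed PiE_iff intro!: restrict_ext\<close>)
qed

lemma H_po_group: "po_group H"
proof (rule po_groupI[OF H_group])
  fix a assume "a \<in> carrier H"
  then show "a \<preceq>\<^bsub>H\<^esub> a"
    by (cases a) (auto simp: H_carrier H_le po_refl PiE_iff)
next
  fix a b assume "a \<in> carrier H" "b \<in> carrier H" "a \<preceq>\<^bsub>H\<^esub> b" "b \<preceq>\<^bsub>H\<^esub> a"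
  then show "a = b"
    by (cases a; cases b) (simp add: H_carrier H_le, metis PiE_ext PiE_mem order_less_asym po_antisym)
next
  fix a b c
  assume abc: "a \<in> carrier H" "b \<in> carrier H" "c \<in> carrier H" "a \<preceq>\<^bsub>H\<^esub> b" "b \<preceq>\<^bsub>H\<^esub> c"
  obtain n x m y k z where eqs [simp]: "a = (n, x)" "b = (m, y)" "c = (k, z)"
    by (metis surj_pair)
  have "x i \<in> carrier G" "y i \<in> carrier G" "z i \<in> carrier G" if "i \<in> I" for i
    using abc(1-3) that by (auto simp: H_carrier)
  then have "\<forall>i\<in>I. x i \<preceq> z i" if "\<forall>i\<in>I. x i \<preceq> y i" "\<forall>i\<in>I. y i \<preceq> z i"
    using that po_trans by meson
  then show "a \<preceq>\<^bsub>H\<^esub> c"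
    using abc(4,5) by (auto simp: H_le)
next
  fix a b c d
  assume "a \<in> carrier H" "b \<in> carrier H" "c \<in> carrier H" "d \<in> carrier H" "a \<preceq>\<^bsub>H\<^esub> b"
  then show "c \<otimes>\<^bsub>H\<^esub> a \<otimes>\<^bsub>H\<^esub> d \<preceq>\<^bsub>H\<^esub> c \<otimes>\<^bsub>H\<^esub> b \<otimes>\<^bsub>H\<^esub> d"
    \<comment> \<open>If \<open>a\<close> and \<open>b\<close> have equal degree, \<open>d\<close>
      is read at the same index on both sides, and the inequality is used at the index shifted by
      the degree of \<open>c\<close>. A strict inequality of degrees survives addition.\<close>
    by (cases a; cases b; cases c; cases d)
      (auto simp: H_carrier H_le H_mult PiE_iff iter_closed intro!: translate)
qed

sublocale H: po_group H
  by (rule H_po_group)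

lemma unit_pow: "(1, \<lambda>i\<in>I. \<one>) [^]\<^bsub>H\<^esub> (k::nat) = (int k, \<lambda>i\<in>I. \<one>)"
  by (induction k) (auto simp: H_one H_mult iter_closed intro!: restrict_ext)

lemma unital: "unital_po_group H (1, \<lambda>i\<in>I. \<one>)"
proof -
  have "\<exists>k::nat. 1 \<le> k \<and> h \<preceq>\<^bsub>H\<^esub> (1, \<lambda>i\<in>I. \<one>) [^]\<^bsub>H\<^esub> k" for h
    unfolding unit_pow
    \<comment> \<open>The summand 1 makes the degree of the power strictly exceed that of
      \<open>h\<close>, so coordinates do not matter; it also gives \<open>k \<ge> 1\<close> when
      \<open>nat\<close> truncates a negative degree to 0.\<close>
    by (rule exI[of _ "nat (fst h) + 1"]) (auto intro!: H_le_if_fst_less)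
  then show ?thesis
    by (simp add: unital_po_group_def strong_unit_def H_po_group pos_cone_def H_carrier H_one H_le)
qed

section \<open>The positive cone and the elements of degree zero\<close>

lemma H_pos_cone:
  "(n, x) \<in> pos_cone H \<longleftrightarrow>
    x \<in> I \<rightarrow>\<^sub>E carrier G \<and> (0 < n \<or> n = 0 \<and> x \<in> I \<rightarrow>\<^sub>E pos_cone G)"
  by (auto simp: pos_cone_def H_carrier H_one H_le PiE_iff)

lemma H_pos_cone_zero: "(0, x) \<in> pos_cone H \<longleftrightarrow> x \<in> I \<rightarrow>\<^sub>E pos_cone G"
  by (auto simp: H_pos_cone PiE_iff dest: pos_cone_carrier)

lemma fst_nonneg: "a \<in> pos_cone H \<Longrightarrow> 0 \<le> fst a"
  by (cases a) (auto simp: H_pos_cone)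

text \<open>The zeroth iterate fixes every index in \<open>I\<close>, so the twist
  disappears.\<close>

lemma H_mult_zero: "(0, x) \<otimes>\<^bsub>H\<^esub> (0, y) = (0, \<lambda>i\<in>I. x i \<otimes> y i)"
  by (auto simp: H_mult iter_zero intro!: restrict_ext)

lemma restrict_PiE_eq: "x \<in> I \<rightarrow>\<^sub>E A \<Longrightarrow> (x = (\<lambda>i\<in>I. f i)) = (\<forall>i\<in>I. x i = f i)"
  by (auto simp: PiE_iff extensional_def fun_eq_iff)

text \<open>Product and positivity in degree 0 are both coordinatewise. Assuming the entries
  extensional suffices, since either side forces their values into the positive cone.\<close>

lemma decomposition_zero_iff:
  assumes "a1 \<in> I \<rightarrow>\<^sub>E carrier G" "a2 \<in> I \<rightarrow>\<^sub>E carrier G" "b1 \<in> I \<rightarrow>\<^sub>E carrier G" "b2 \<in> I \<rightarrow>\<^sub>E carrier G"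
    and "x11 \<in> extensional I" "x12 \<in> extensional I" "x21 \<in> extensional I" "x22 \<in> extensional I"
  shows "decomposition H (0, a1) (0, a2) (0, b1) (0, b2) (0, x11) (0, x12) (0, x21) (0, x22) \<longleftrightarrow>
    (\<forall>i\<in>I. decomposition G (a1 i) (a2 i) (b1 i) (b2 i) (x11 i) (x12 i) (x21 i) (x22 i))"
  using assms
  by (auto simp: decomposition_def H_pos_cone_zero H_mult_zero restrict_PiE_eq PiE_iff[of _ I "\<lambda>_. pos_cone G"])

text \<open>Positive elements have nonnegative degree, and the degrees in each row add up to 0.
  Hence a table found in \<open>H\<close> already lies in the copy of the power of
  \<open>G\<close>.\<close>

lemma decomposition_zero_degrees:
  assumes "decomposition H a1 a2 b1 b2 c11 c12 c21 c22" "fst a1 = 0" "fst a2 = 0"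
  shows "fst c11 = 0" "fst c12 = 0" "fst c21 = 0" "fst c22 = 0"
proof -
  have "0 \<le> fst c11" "0 \<le> fst c12" "0 \<le> fst c21" "0 \<le> fst c22"
    using assms(1) by (simp_all add: decomposition_def fst_nonneg)
  moreover have "fst a1 = fst c11 + fst c12" "fst a2 = fst c21 + fst c22"
    using assms(1) by (simp_all only: decomposition_def fst_H_mult)
  ultimately show "fst c11 = 0" "fst c12 = 0" "fst c21 = 0" "fst c22 = 0"
    using assms(2,3) by linarith+
qed

lemma common_lower_bound:
  assumes dir: "directed G" and a: "a \<in> pos_cone H" and b: "b \<in> pos_cone H" and eq: "fst a = fst b"
  shows "\<exists>d \<in> pos_cone H. fst d = fst a \<and> d \<preceq>\<^bsub>H\<^esub> a \<and> d \<preceq>\<^bsub>H\<^esub> b"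
proof (cases "fst a = 0")
  case True
  then show ?thesis
    \<comment> \<open>In degree 0 the bound must itself have positive coordinates; the identity
      serves.\<close>
    using H.one_in_pos_cone a b by (intro bexI[of _ "\<one>\<^bsub>H\<^esub>"]) (auto simp: pos_cone_def H_one)
next
  case False
  obtain n x y where n: "a = (n, x)" "b = (n, y)"
    using eq by (metis prod.collapse)
  have "\<forall>i\<in>I. \<exists>z \<in> carrier G. z \<preceq> x i \<and> z \<preceq> y i"
    using a b n by (auto intro!: directed_lower_bound[OF dir] simp: H_pos_cone)
  then obtain z where z: "\<forall>i\<in>I. z i \<in> carrier G \<and> z i \<preceq> x i \<and> z i \<preceq> y i"
    by metis
  have "0 < n"
    using fst_nonneg[OF a] False n by simp
  then show ?thesis
    \<comment> \<open>In degree \<open>n > 0\<close> positivity puts no condition on the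
      coordinates, so arbitrary lower bounds chosen coordinatewise will do.\<close>
    using z n by (intro bexI[of _ "(n, restrict z I)"]) (auto simp: H_pos_cone H_le)
qed

lemma fst_H_inv: "a \<in> carrier H \<Longrightarrow> fst (inv\<^bsub>H\<^esub> a) = - fst a"
  using fst_H_mult[of "inv\<^bsub>H\<^esub> a" a] by (simp add: H_one)

section \<open>Transfer of the decomposition properties\<close>

text \<open>The equation is solved in each coordinate separately and the solutions are assembled by
  choice; \<open>PQ\<close> collects the coordinatewise side conditions.\<close>

lemma RDP_with_H_zero:
  assumes rdp: "RDP_with Q G"
    and PQ: "\<And>x y. \<lbrakk>x \<in> I \<rightarrow>\<^sub>E pos_cone G; y \<in> I \<rightarrow>\<^sub>E pos_cone G; \<forall>i\<in>I. Q (x i) (y i)\<rbrakk>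
      \<Longrightarrow> P (0, x) (0, y)"
    and pos: "a1 \<in> pos_cone H" "a2 \<in> pos_cone H" "b1 \<in> pos_cone H" "b2 \<in> pos_cone H"
    and zero: "fst a1 = 0" "fst a2 = 0" "fst b1 = 0" "fst b2 = 0"
    and eq: "a1 \<otimes>\<^bsub>H\<^esub> a2 = b1 \<otimes>\<^bsub>H\<^esub> b2"
  shows "\<exists>c11 c12 c21 c22. decomposition H a1 a2 b1 b2 c11 c12 c21 c22 \<and> P c12 c21"
proof -
  obtain x1 x2 y1 y2 where [simp]: "a1 = (0, x1)" "a2 = (0, x2)" "b1 = (0, y1)" "b2 = (0, y2)"
    using zero by (metis prod.collapse)
  have xy: "x1 \<in> I \<rightarrow>\<^sub>E pos_cone G" "x2 \<in> I \<rightarrow>\<^sub>E pos_cone G"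
    "y1 \<in> I \<rightarrow>\<^sub>E pos_cone G" "y2 \<in> I \<rightarrow>\<^sub>E pos_cone G"
    using pos by (simp_all add: H_pos_cone_zero)
  have carr: "x1 \<in> I \<rightarrow>\<^sub>E carrier G" "x2 \<in> I \<rightarrow>\<^sub>E carrier G"
    "y1 \<in> I \<rightarrow>\<^sub>E carrier G" "y2 \<in> I \<rightarrow>\<^sub>E carrier G"
    using xy by (auto simp: PiE_iff pos_cone_def)
  have "x1 i \<otimes> x2 i = y1 i \<otimes> y2 i" if "i \<in> I" for i
    using fun_cong[OF arg_cong[OF eq, of snd], of i] that by (simp add: H_mult_zero)
  then have "\<forall>i\<in>I. \<exists>c11 c12 c21 c22.
      decomposition G (x1 i) (x2 i) (y1 i) (y2 i) c11 c12 c21 c22 \<and> Q c12 c21"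
    using xy by (intro ballI RDP_withD[OF rdp]) (auto simp: PiE_iff)
  then obtain c11 c12 c21 c22 where c: "\<forall>i\<in>I.
      decomposition G (x1 i) (x2 i) (y1 i) (y2 i) (c11 i) (c12 i) (c21 i) (c22 i) \<and> Q (c12 i) (c21 i)"
    by metis
  have "decomposition H a1 a2 b1 b2
      (0, restrict c11 I) (0, restrict c12 I) (0, restrict c21 I) (0, restrict c22 I)"
    using c by (simp add: decomposition_zero_iff carr)
  moreover have "P (0, restrict c12 I) (0, restrict c21 I)"
    using c by (intro PQ) (auto simp: decomposition_def)
  ultimately show ?thesis
    by blast
qed

text \<open>\<open>PQ\<close> serves the case of equal degrees, after reduction to degree 0;
  \<open>P_one\<close> serves unequal degrees, where one off-diagonal entry is the identity.\<close>

lemma RDP_with_HI: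
  assumes dir: "directed G" and rdp: "RDP_with Q G"
    and PQ: "\<And>x y. \<lbrakk>x \<in> I \<rightarrow>\<^sub>E pos_cone G; y \<in> I \<rightarrow>\<^sub>E pos_cone G; \<forall>i\<in>I. Q (x i) (y i)\<rbrakk>
      \<Longrightarrow> P (0, x) (0, y)"
    and P_one: "\<And>c. c \<in> pos_cone H \<Longrightarrow> P \<one>\<^bsub>H\<^esub> c" "\<And>c. c \<in> pos_cone H \<Longrightarrow> P c \<one>\<^bsub>H\<^esub>"
  shows "RDP_with P H"
  unfolding RDP_with_def
proof (intro ballI impI)
  fix a1 a2 b1 b2
  assume pos: "a1 \<in> pos_cone H" "a2 \<in> pos_cone H" "b1 \<in> pos_cone H" "b2 \<in> pos_cone H"
    and eq: "a1 \<otimes>\<^bsub>H\<^esub> a2 = b1 \<otimes>\<^bsub>H\<^esub> b2"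
  note carr = pos[THEN pos_cone_carrier]
  consider "fst b1 < fst a1" | "fst a1 < fst b1" | "fst a1 = fst b1"
    by linarith
  then show "\<exists>c11 c12 c21 c22. decomposition H a1 a2 b1 b2 c11 c12 c21 c22 \<and> P c12 c21"
  proof cases
    case 1
    then have "decomposition H a1 a2 b1 b2 b1 (inv\<^bsub>H\<^esub> b1 \<otimes>\<^bsub>H\<^esub> a1) \<one>\<^bsub>H\<^esub> a2"
      by (intro H.decomposition_of_le_left pos eq H_le_if_fst_less)
    moreover from this have "P (inv\<^bsub>H\<^esub> b1 \<otimes>\<^bsub>H\<^esub> a1) \<one>\<^bsub>H\<^esub>"
      by (intro P_one) (simp add: decomposition_def)
    ultimately show ?thesis by blast
  next
    case 2
    \<comment> \<open>The previous case with the two factorizations exchanged; transposing the table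
      restores the roles.\<close>
    then have "decomposition H b1 b2 a1 a2 a1 (inv\<^bsub>H\<^esub> a1 \<otimes>\<^bsub>H\<^esub> b1) \<one>\<^bsub>H\<^esub> b2"
      by (intro H.decomposition_of_le_left pos eq[symmetric] H_le_if_fst_less)
    then have "decomposition H a1 a2 b1 b2 a1 \<one>\<^bsub>H\<^esub> (inv\<^bsub>H\<^esub> a1 \<otimes>\<^bsub>H\<^esub> b1) b2"
      by (rule H.decomposition_swap)
    moreover from this have "P \<one>\<^bsub>H\<^esub> (inv\<^bsub>H\<^esub> a1 \<otimes>\<^bsub>H\<^esub> b1)"
      by (intro P_one) (simp add: decomposition_def)
    ultimately show ?thesis by blast
  next
    case 3
    have "fst a1 + fst a2 = fst b1 + fst b2"
      using eq by (metis fst_H_mult)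
    with 3 have deg2: "fst a2 = fst b2"
      by simp
    obtain d where d: "d \<in> pos_cone H" "fst d = fst a1" "d \<preceq>\<^bsub>H\<^esub> a1" "d \<preceq>\<^bsub>H\<^esub> b1"
      using common_lower_bound[OF dir pos(1,3) 3] by blast
    obtain d' where d': "d' \<in> pos_cone H" "fst d' = fst a2" "d' \<preceq>\<^bsub>H\<^esub> a2" "d' \<preceq>\<^bsub>H\<^esub> b2"
      using common_lower_bound[OF dir pos(2,4) deg2] by blast
    note dcarr = d(1)[THEN pos_cone_carrier] d'(1)[THEN pos_cone_carrier]
    define p p' q q' where
      "p = inv\<^bsub>H\<^esub> d \<otimes>\<^bsub>H\<^esub> a1" "p' = a2 \<otimes>\<^bsub>H\<^esub> inv\<^bsub>H\<^esub> d'"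
      "q = inv\<^bsub>H\<^esub> d \<otimes>\<^bsub>H\<^esub> b1" "q' = b2 \<otimes>\<^bsub>H\<^esub> inv\<^bsub>H\<^esub> d'"
    note pq = this
    have "p \<otimes>\<^bsub>H\<^esub> p' = inv\<^bsub>H\<^esub> d \<otimes>\<^bsub>H\<^esub> (a1 \<otimes>\<^bsub>H\<^esub> a2) \<otimes>\<^bsub>H\<^esub> inv\<^bsub>H\<^esub> d'"
      "q \<otimes>\<^bsub>H\<^esub> q' = inv\<^bsub>H\<^esub> d \<otimes>\<^bsub>H\<^esub> (b1 \<otimes>\<^bsub>H\<^esub> b2) \<otimes>\<^bsub>H\<^esub> inv\<^bsub>H\<^esub> d'"
      using carr dcarr by (simp_all add: pq H.m_assoc)
    then have pq_eq: "p \<otimes>\<^bsub>H\<^esub> p' = q \<otimes>\<^bsub>H\<^esub> q'"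
      by (simp add: eq)
    have pq_pos: "p \<in> pos_cone H" "p' \<in> pos_cone H" "q \<in> pos_cone H" "q' \<in> pos_cone H"
      using carr dcarr d d'
      by (simp_all add: pq H.inv_mult_in_pos_cone H.mult_inv_in_pos_cone)
    \<comment> \<open>\<open>d\<close> and \<open>d'\<close> carry the full degrees of the factors,
      so the quotients have degree 0.\<close>
    have "fst p = 0" "fst p' = 0" "fst q = 0" "fst q' = 0"
      using dcarr d(2) d'(2) 3 deg2 by (simp_all add: pq fst_H_mult fst_H_inv)
    from RDP_with_H_zero[of Q P, OF rdp PQ pq_pos this pq_eq]
    obtain c11 c12 c21 c22 where c: "decomposition H p p' q q' c11 c12 c21 c22" and P: "P c12 c21"
      by blast
    have "d \<otimes>\<^bsub>H\<^esub> p = a1" "p' \<otimes>\<^bsub>H\<^esub> d' = a2" "d \<otimes>\<^bsub>H\<^esub> q = b1" "q' \<otimes>\<^bsub>H\<^esub> d' = b2"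
      using carr dcarr by (simp_all add: pq H.m_assoc H.inv_solve_left' flip: H.m_assoc)
        (simp_all add: H.m_assoc)
    with H.decomposition_mult_outer[OF c d(1) d'(1)]
    have "decomposition H a1 a2 b1 b2 (d \<otimes>\<^bsub>H\<^esub> c11) c12 c21 (c22 \<otimes>\<^bsub>H\<^esub> d')"
      by simp
    with P show ?thesis by blast
  qed
qed

text \<open>Elements of \<open>G\<close> are embedded as constant sequences of degree 0, and a table
  for these is read off at a single coordinate.\<close>

lemma RDP_with_HD:
  assumes rdp: "RDP_with P H" and "I \<noteq> {}"
    and PQ: "\<And>x y i. \<lbrakk>x \<in> I \<rightarrow>\<^sub>E pos_cone G; y \<in> I \<rightarrow>\<^sub>E pos_cone G; P (0, x) (0, y); i \<in> I\<rbrakk>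
      \<Longrightarrow> Q (x i) (y i)"
  shows "RDP_with Q G"
  unfolding RDP_with_def
proof (intro ballI impI)
  fix a1 a2 b1 b2
  assume pos: "a1 \<in> pos_cone G" "a2 \<in> pos_cone G" "b1 \<in> pos_cone G" "b2 \<in> pos_cone G"
    and eq: "a1 \<otimes> a2 = b1 \<otimes> b2"
  note carr = pos[THEN pos_cone_carrier]
  obtain i where i: "i \<in> I"
    using \<open>I \<noteq> {}\<close> by blast
  let ?k = "\<lambda>a. (0::int, \<lambda>j\<in>I. a)"
  have "?k a1 \<otimes>\<^bsub>H\<^esub> ?k a2 = ?k b1 \<otimes>\<^bsub>H\<^esub> ?k b2"
    using eq by (simp add: H_mult_zero cong: restrict_cong)
  then obtain c11 c12 c21 c22
    where c: "decomposition H (?k a1) (?k a2) (?k b1) (?k b2) c11 c12 c21 c22" and P: "P c12 c21"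
    using RDP_withD[OF rdp, of "?k a1" "?k a2" "?k b1" "?k b2"] pos
    by (auto simp: H_pos_cone_zero)
  have "fst c11 = 0" "fst c12 = 0" "fst c21 = 0" "fst c22 = 0"
    using decomposition_zero_degrees[OF c] by simp_all
  then obtain x11 x12 x21 x22
    where x [simp]: "c11 = (0, x11)" "c12 = (0, x12)" "c21 = (0, x21)" "c22 = (0, x22)"
    by (metis prod.collapse)
  have x_pos: "x11 \<in> I \<rightarrow>\<^sub>E pos_cone G" "x12 \<in> I \<rightarrow>\<^sub>E pos_cone G"
    "x21 \<in> I \<rightarrow>\<^sub>E pos_cone G" "x22 \<in> I \<rightarrow>\<^sub>E pos_cone G"
    using c by (simp_all add: decomposition_def H_pos_cone_zero)
  have "decomposition G a1 a2 b1 b2 (x11 i) (x12 i) (x21 i) (x22 i)"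
    using c carr x_pos i
      decomposition_zero_iff[of "\<lambda>j\<in>I. a1" "\<lambda>j\<in>I. a2" "\<lambda>j\<in>I. b1" "\<lambda>j\<in>I. b2" x11 x12 x21 x22]
    by (auto simp: PiE_iff)
  moreover have "Q (x12 i) (x21 i)"
    using x_pos P i by (intro PQ) simp_all
  ultimately show "\<exists>c11 c12 c21 c22. decomposition G a1 a2 b1 b2 c11 c12 c21 c22 \<and> Q c12 c21"
    by blast
qed

text \<open>This isolates what each property must supply: a side condition that is coordinatewise in
  degree 0 and holds whenever one entry is the identity.\<close>

lemma RDP_with_H_iff:
  assumes "directed G" "I \<noteq> {}"
    and "\<And>x y. \<lbrakk>x \<in> I \<rightarrow>\<^sub>E pos_cone G; y \<in> I \<rightarrow>\<^sub>E pos_cone G\<rbrakk>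
      \<Longrightarrow> P (0, x) (0, y) \<longleftrightarrow> (\<forall>i\<in>I. Q (x i) (y i))"
    and "\<And>c. c \<in> pos_cone H \<Longrightarrow> P \<one>\<^bsub>H\<^esub> c" "\<And>c. c \<in> pos_cone H \<Longrightarrow> P c \<one>\<^bsub>H\<^esub>"
  shows "RDP_with P H \<longleftrightarrow> RDP_with Q G"
  using RDP_with_HI[of Q P] RDP_with_HD[of P Q] assms by blast

section \<open>Coordinatewise form of the side conditions\<close>

abbreviation single :: "'i \<Rightarrow> 'a \<Rightarrow> 'i \<Rightarrow> 'a" where
  "single i g \<equiv> \<lambda>j\<in>I. if j = i then g else \<one>"

text \<open>Off the coordinate \<open>i\<close> the entry is \<open>\<one>\<close>, which is below
  every positive element. Here \<open>g\<close> may fail to be positive, as the argument on meets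
  requires.\<close>

lemma single_le:
  assumes "x \<in> I \<rightarrow>\<^sub>E pos_cone G" "g \<preceq> x i"
  shows "(0, single i g) \<preceq>\<^bsub>H\<^esub> (0, x)"
  using assms by (auto simp: H_le dest!: PiE_mem pos_coneD)

text \<open>The degree of \<open>a\<close> is squeezed between 0 and 0, so the order is decided by
  the coordinates.\<close>

lemma pos_below_zero:
  assumes "a \<in> pos_cone H" "a \<preceq>\<^bsub>H\<^esub> (0, x)"
  obtains y where "a = (0, y)" "y \<in> I \<rightarrow>\<^sub>E pos_cone G" "\<forall>i\<in>I. y i \<preceq> x i"
  using assms by (cases a) (auto simp: H_pos_cone H_le)

text \<open>Sequences supported at one coordinate reduce commutation in \<open>G\<close> to
  commutation in \<open>H\<close>; conversely, everything positive below \<open>(0, x)\<close> or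
  \<open>(0, y)\<close> has degree 0 and multiplies coordinatewise.\<close>

lemma commuting_below_zero_iff:
  assumes x: "x \<in> I \<rightarrow>\<^sub>E pos_cone G" and y: "y \<in> I \<rightarrow>\<^sub>E pos_cone G"
  shows "commuting_below H (0, x) (0, y) \<longleftrightarrow> (\<forall>i\<in>I. commuting_below G (x i) (y i))"
proof (intro iffI ballI)
  fix i assume comm: "commuting_below H (0, x) (0, y)" and i: "i \<in> I"
  show "commuting_below G (x i) (y i)"
    unfolding commuting_below_def
  proof (intro ballI impI)
    fix s t assume st: "s \<in> pos_cone G" "t \<in> pos_cone G" "s \<preceq> x i \<and> t \<preceq> y i"
    then have "(0, single i s) \<otimes>\<^bsub>H\<^esub> (0, single i t) = (0, single i t) \<otimes>\<^bsub>H\<^esub> (0, single i s)"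
      using single_le[OF x, of s i] single_le[OF y, of t i] one_in_pos_cone
      by (intro comm[unfolded commuting_below_def, rule_format]) (auto simp: H_pos_cone_zero)
    then show "s \<otimes> t = t \<otimes> s"
      using i by (auto simp: H_mult_zero dest!: fun_cong[of _ _ i])
  qed
next
  assume comm: "\<forall>i\<in>I. commuting_below G (x i) (y i)"
  show "commuting_below H (0, x) (0, y)"
    unfolding commuting_below_def
  proof (intro ballI impI)
    fix a b assume ab: "a \<in> pos_cone H" "b \<in> pos_cone H" "a \<preceq>\<^bsub>H\<^esub> (0, x) \<and> b \<preceq>\<^bsub>H\<^esub> (0, y)"
    obtain s where s: "a = (0, s)" "s \<in> I \<rightarrow>\<^sub>E pos_cone G" "\<forall>i\<in>I. s i \<preceq> x i"
      using ab pos_below_zero[of a x] by blast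
    obtain t where t: "b = (0, t)" "t \<in> I \<rightarrow>\<^sub>E pos_cone G" "\<forall>i\<in>I. t i \<preceq> y i"
      using ab pos_below_zero[of b y] by blast
    have "s i \<otimes> t i = t i \<otimes> s i" if "i \<in> I" for i
      using that s t by (intro comm[unfolded commuting_below_def, rule_format, of i]) auto
    then show "a \<otimes>\<^bsub>H\<^esub> b = b \<otimes>\<^bsub>H\<^esub> a"
      unfolding s t H_mult_zero by (simp cong: restrict_cong)
  qed
qed

lemma is_meet_zero_iff:
  assumes x: "x \<in> I \<rightarrow>\<^sub>E pos_cone G" and y: "y \<in> I \<rightarrow>\<^sub>E pos_cone G"
  shows "is_meet H \<one>\<^bsub>H\<^esub> (0, x) (0, y) \<longleftrightarrow> (\<forall>i\<in>I. is_meet G \<one> (x i) (y i))"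
proof -
  have carr: "x \<in> I \<rightarrow>\<^sub>E carrier G" "y \<in> I \<rightarrow>\<^sub>E carrier G"
    and pos: "\<forall>i\<in>I. x i \<in> carrier G \<and> \<one> \<preceq> x i" "\<forall>i\<in>I. y i \<in> carrier G \<and> \<one> \<preceq> y i"
    using x y by (auto simp: PiE_iff pos_cone_def)
  show ?thesis
  proof (intro iffI ballI)
    fix i assume meet: "is_meet H \<one>\<^bsub>H\<^esub> (0, x) (0, y)" and i: "i \<in> I"
    \<comment> \<open>The infimum is taken in all of \<open>G\<close>, so \<open>g\<close> is an
      arbitrary lower bound; it is tested through \<open>single i g\<close>.\<close>
    have "g \<preceq> \<one>" if g: "g \<in> carrier G" "g \<preceq> x i" "g \<preceq> y i" for g
    proof -
      have "(0, single i g) \<preceq>\<^bsub>H\<^esub> \<one>\<^bsub>H\<^esub>"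
        using meet g single_le[OF x, of g i] single_le[OF y, of g i]
        by (auto simp: is_meet_iff H_carrier)
      then show ?thesis
        using i by (auto simp: H_one H_le)
    qed
    then show "is_meet G \<one> (x i) (y i)"
      using pos i by (auto simp: is_meet_iff)
  next
    assume meet: "\<forall>i\<in>I. is_meet G \<one> (x i) (y i)"
    have "(n, z) \<preceq>\<^bsub>H\<^esub> \<one>\<^bsub>H\<^esub>"
      if "(n, z) \<in> carrier H" "(n, z) \<preceq>\<^bsub>H\<^esub> (0, x)" "(n, z) \<preceq>\<^bsub>H\<^esub> (0, y)" for n z
      \<comment> \<open>A lower bound of negative degree is below the identity at once, positive
        degree is impossible, and degree 0 is settled in each coordinate.\<close>
      using that meet by (auto simp: H_one H_le H_carrier is_meet_iff dest: PiE_mem)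
    moreover have "\<one>\<^bsub>H\<^esub> \<preceq>\<^bsub>H\<^esub> (0, x)" "\<one>\<^bsub>H\<^esub> \<preceq>\<^bsub>H\<^esub> (0, y)"
      using pos by (auto simp: H_one H_le)
    ultimately show "is_meet H \<one>\<^bsub>H\<^esub> (0, x) (0, y)"
      using carr by (auto simp: is_meet_iff H_carrier)
  qed
qed

end

theorem theorem3p4:
  fixes G :: "('a, 'b) po_group_scheme"
    and I :: "'i set"
    and \<phi> :: "'i \<Rightarrow> 'i"
    and u :: "int \<times> ('i \<Rightarrow> 'a)"
  assumes "po_group G"
    and "directed G"
    and "I \<noteq> {}"
    and "bij_betw \<phi> I I"
    and "u = (1, \<lambda>i\<in>I. \<one>\<^bsub>G\<^esub>)"
  shows "unital_po_group (semidirect I \<phi> G) u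
    \<and> (RDP (semidirect I \<phi> G) \<longleftrightarrow> RDP G)
    \<and> (RDP1 (semidirect I \<phi> G) \<longleftrightarrow> RDP1 G)
    \<and> (RDP2 (semidirect I \<phi> G) \<longleftrightarrow> RDP2 G)"
proof -
  interpret semidirect_power G I \<phi>
    using assms(1,4) by (simp add: semidirect_power_def semidirect_power_axioms_def)
  have "RDP H \<longleftrightarrow> RDP G"
    unfolding RDP_eq_RDP_with by (rule RDP_with_H_iff) (use assms in simp_all)
  moreover have "RDP1 H \<longleftrightarrow> RDP1 G"
    unfolding RDP1_eq_RDP_with
    by (rule RDP_with_H_iff) (use assms in \<open>simp_all add: commuting_below_zero_iff
      H.commuting_below_one_left H.commuting_below_one_right\<close>)
  moreover have "RDP2 H \<longleftrightarrow> RDP2 G"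
    unfolding RDP2_eq_RDP_with
    by (rule RDP_with_H_iff) (use assms in \<open>simp_all add: is_meet_zero_iff
      H.is_meet_one_left H.is_meet_one_right\<close>)
  ultimately show ?thesis
    using unital assms(5) by blast
qed

end
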